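(* Let $n \geq 1$ and $d \geq 2$ be integers and let $\mathbf{x} = (x^1,\ldots,x^d) \in (\mathcal{P}_n)^d$. Then $$\mathrm{EMD}(\mathbf{x}) = \frac{1}{d-1}\left[ G''(\mathbf{x};1) + \sum_{1 \leq k < \ell \leq d} \mathrm{EMD}(x^k, x^\ell) \right],$$ where $G''(\mathbf{x};1)$ is the second derivative with respect to $q$, evaluated at $q=1$, of the polynomial $$G(\mathbf{x};q) = \sum_{i=1}^{d-1}\sum_{j=1}^n \Delta X^{(i)}_j \cdot q^{\min\{i,\, d-i\}} .$$
   Context: $\mathcal{P}_n = \{x = (x_1,\ldots,x_{n+1}) \in \mathbb{R}^{n+1} : \sum_j x_j = 1,\ x_j \geq 0\}$ is the standard $n$-simplex, viewed as the set of probability distributions on $[n+1] = \{1,\ldots,n+1\}$. Generalized earth mover's distance: for any integer $e \geq 2$ and $y = (y_1,\ldots,y_e) \in \mathbb{R}^e$, let $C(y) = \min_{a \in \mathbb{R}} \big(|y_1 - a| + \cdots + |y_e - a|\big)$. For $w^1,\ldots,w^e \in \mathcal{P}_n$, with $w^i_j$ the $j$th component of $w^i$, $\mathrm{EMD}(w^1,\ldots,w^e)$ is the minimum of $\sum_{y \in [n+1]^e} C(y)\, T(y)$ over all arrays $T : [n+1]^e \to \mathbb{R}$ such that $T(y) \geq 0$ for all $y$ and $\sum_{y :\, y_i = j} T(y) = w^i_j$ for all $i \in \{1,\ldots,e\}$ and $j \in \{1,\ldots,n+1\}$. Thus $\mathrm{EMD}(\mathbf{x})$ is the case $e=d$, and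 $\mathrm{EMD}(x^k,x^\ell)$ is the case $e=2$. Notation for order statistics: for $\mathbf{x} = (x^1,\ldots,x^d)$ and $1 \leq j \leq n$, put $X^i_j = x^i_1 + \cdots + x^i_j$. Let $X^{(i)}_j$ be the $i$th smallest among $X^1_j,\ldots,X^d_j$ (counted with multiplicity), and for $1 \leq i \leq d-1$ let $\Delta X^{(i)}_j = X^{(i+1)}_j - X^{(i)}_j$. *)

theory Defs
  imports Complex_Main "HOL-Library.FuncSet" "HOL-Computational_Algebra.Polynomial"
begin

text \<open>
  All families are indexed from 1: a point of \<open>\<real>\<^sup>n\<^sup>+\<^sup>1\<close> is a function \<open>nat \<Rightarrow> real\<close> of which only the
  values on \<open>{1..n+1}\<close> matter, and a tuple \<open>(w\<^sup>1, \<dots>, w\<^sup>e)\<close> of such points is a function \<open>w\<close> of which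
  only the values on \<open>{1..e}\<close> matter; \<open>w i j\<close> is the \<open>j\<close>th component of \<open>w\<^sup>i\<close>.
\<close>

definition prob_simplex :: "nat \<Rightarrow> (nat \<Rightarrow> real) set" where
  "prob_simplex n = {x. (\<Sum>j=1..n+1. x j) = 1 \<and> (\<forall>j\<in>{1..n+1}. 0 \<le> x j)}"

text \<open>
  Minima are rendered by \<open>LEAST\<close>, which denotes the least element of a set of reals (not merely
  its infimum).
\<close>

definition emd_cost :: "nat \<Rightarrow> (nat \<Rightarrow> real) \<Rightarrow> real" where
  "emd_cost e y = (LEAST v. \<exists>a::real. v = (\<Sum>i=1..e. \<bar>y i - a\<bar>))"

definition grid :: "nat \<Rightarrow> nat \<Rightarrow> (nat \<Rightarrow> nat) set" where
  "grid n e = {1..e} \<rightarrow>\<^sub>E {1..n+1}"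

definition transport_plans ::
    "nat \<Rightarrow> nat \<Rightarrow> (nat \<Rightarrow> nat \<Rightarrow> real) \<Rightarrow> ((nat \<Rightarrow> nat) \<Rightarrow> real) set" where
  "transport_plans n e w =
    {T. (\<forall>y\<in>grid n e. 0 \<le> T y) \<and>
        (\<forall>i\<in>{1..e}. \<forall>j\<in>{1..n+1}. (\<Sum>y\<in>{y\<in>grid n e. y i = j}. T y) = w i j)}"

definition EMD :: "nat \<Rightarrow> nat \<Rightarrow> (nat \<Rightarrow> nat \<Rightarrow> real) \<Rightarrow> real" where
  "EMD n e w =
    (LEAST v. \<exists>T\<in>transport_plans n e w.
       v = (\<Sum>y\<in>grid n e. emd_cost e (\<lambda>i. real (y i)) * T y))"

definition EMD_pair :: "nat \<Rightarrow> (nat \<Rightarrow> real) \<Rightarrow> (nat \<Rightarrow> real) \<Rightarrow> real" where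
  "EMD_pair n u v = EMD n 2 (\<lambda>i. if i = 1 then u else v)"

definition cumul :: "(nat \<Rightarrow> nat \<Rightarrow> real) \<Rightarrow> nat \<Rightarrow> nat \<Rightarrow> real" where
  "cumul x i j = (\<Sum>m=1..j. x i m)"

text \<open>The \<open>i\<close>th smallest of \<open>X\<^sup>1\<^sub>j, \<dots>, X\<^sup>d\<^sub>j\<close> for \<open>1 \<le> i \<le> d\<close>; list positions are counted from 0.\<close>

definition order_stat :: "nat \<Rightarrow> (nat \<Rightarrow> nat \<Rightarrow> real) \<Rightarrow> nat \<Rightarrow> nat \<Rightarrow> real" where
  "order_stat d x i j = sort (map (\<lambda>k. cumul x k j) [1..<d+1]) ! (i - 1)"

definition delta_stat :: "nat \<Rightarrow> (nat \<Rightarrow> nat \<Rightarrow> real) \<Rightarrow> nat \<Rightarrow> nat \<Rightarrow> real" where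
  "delta_stat d x i j = order_stat d x (i + 1) j - order_stat d x i j"

definition G_poly :: "nat \<Rightarrow> nat \<Rightarrow> (nat \<Rightarrow> nat \<Rightarrow> real) \<Rightarrow> real poly" where
  "G_poly n d x = (\<Sum>i=1..d-1. \<Sum>j=1..n. monom (delta_stat d x i j) (min i (d - i)))"

end

theory Submission
  imports Defs "HOL-Analysis.Analysis"
begin

text \<open>
  The multi-marginal transport problem splits over the cut points \<open>j\<close>: an integer in
  \<open>{1..n+1}\<close> is determined by its threshold indicators \<open>[y \<le> j]\<close>, and \<open>\<bar>y - m\<bar>\<close> is the number of
  thresholds separating \<open>y\<close> and \<open>m\<close>. Hence \<open>EMD = \<Sum>\<^sub>j C(X\<^sup>1\<^sub>j, \<dots>, X\<^sup>d\<^sub>j)\<close>: the bound \<open>\<ge>\<close> is the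
  triangle inequality, and \<open>\<le>\<close> is attained by the quantile coupling, in which every coordinate is
  driven by the same uniform random variable. For sorted values with gaps \<open>\<Delta>\<^sub>i\<close>, the cost \<open>C\<close>
  is \<open>\<Sum>\<^sub>i min i (d-i) \<Delta>\<^sub>i\<close> and the sum of pairwise distances is \<open>\<Sum>\<^sub>i i (d-i) \<Delta>\<^sub>i\<close>. With
  \<open>m = min i (d-i)\<close>, the theorem is the identity \<open>m (m-1) + i (d-i) = m (d-1)\<close>, summed.
\<close>

section \<open>Sorted values and the median\<close>

definition sorted_val :: "nat \<Rightarrow> (nat \<Rightarrow> real) \<Rightarrow> nat \<Rightarrow> real" where
  "sorted_val d y i = sort (map y [1..<d+1]) ! (i - 1)"

text \<open>Sorting preserves the multiset of values, so symmetric sums may be evaluated on sorted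
  values.\<close>

lemma sum_sorted_val:
  "(\<Sum>i=1..d. g (sorted_val d y i)) = (\<Sum>i=1..d. g (y i) :: real)"
proof -
  let ?s = "sort (map y [1..<d+1])"
  have "(\<Sum>i=1..d. g (sorted_val d y i)) = (\<Sum>i<d. g (?s ! i))"
    unfolding sorted_val_def
    by (rule sum.reindex_bij_witness[where i=Suc and j="\<lambda>i. i - 1"]) auto
  also have "\<dots> = sum_list (map g ?s)"
    by (simp add: sum_list_sum_nth atLeast0LessThan del: upt_Suc)
  also have "\<dots> = sum_mset (image_mset g (mset ?s))"
    by (metis mset_map sum_mset_sum_list)
  also have "\<dots> = sum_list (map g (map y [1..<d+1]))"
    by (metis mset_map mset_sort sum_mset_sum_list)
  also have "\<dots> = (\<Sum>i=1..d. g (y i))"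
    by (simp add: comp_def interv_sum_list_conv_sum_set_nat atLeastLessThanSuc_atLeastAtMost
        del: upt_Suc)
  finally show ?thesis .
qed

lemma sorted_val_mono:
  assumes "1 \<le> i" "i \<le> k" "k \<le> d"
  shows "sorted_val d y i \<le> sorted_val d y k"
  unfolding sorted_val_def using assms by (intro sorted_nth_mono) auto

lemma sorted_val_attained:
  assumes "i \<in> {1..d}"
  obtains p where "p \<in> {1..d}" "sorted_val d y i = y p"
proof -
  have "sorted_val d y i \<in> set (sort (map y [1..<d+1]))"
    unfolding sorted_val_def using assms by (intro nth_mem) auto
  then show ?thesis using that by (auto simp: less_Suc_eq_le simp del: upt_Suc)
qed

section \<open>Distances expressed through gaps between consecutive sorted values\<close>

definition gap :: "nat \<Rightarrow> (nat \<Rightarrow> real) \<Rightarrow> nat \<Rightarrow> real" where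
  "gap d y i = sorted_val d y (i + 1) - sorted_val d y i"

text \<open>Telescoping: gap \<open>i\<close> contributes exactly when it separates positions
  \<open>k\<close> and \<open>l\<close>. The indicator form lets later sums be counted gap by
  gap.\<close>

lemma abs_diff_sorted_val:
  assumes "k \<in> {1..d}" "l \<in> {1..d}"
  shows "\<bar>sorted_val d y k - sorted_val d y l\<bar> =
    (\<Sum>i=1..d-1. gap d y i * of_bool ((k \<le> i) \<noteq> (l \<le> i)))"
  using assms
proof (induction k l rule: linorder_wlog)
  case (le k l)
  have "(\<Sum>i=1..d-1. gap d y i * of_bool ((k \<le> i) \<noteq> (l \<le> i))) = (\<Sum>i=k..<l. gap d y i)"
    using le by (intro sum.mono_neutral_cong_right) auto
  also have "\<dots> = sorted_val d y l - sorted_val d y k"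
    unfolding gap_def using sum_Suc_diff'[of k l "sorted_val d y"] le by simp
  finally show ?case using sorted_val_mono[of k l d y] le by auto
next
  case (sym k l)
  have "((l \<le> i) \<noteq> (k \<le> i)) = ((k \<le> i) \<noteq> (l \<le> i))" for i by blast
  then show ?case using sym by (simp only: abs_minus_commute[of "sorted_val d y l"])
qed

lemma sum_of_bool_threshold:
  assumes "i \<le> d"
  shows "(\<Sum>k=1..d. of_bool ((k \<le> i) \<noteq> b)) = (if b then real d - real i else real i)"
proof -
  have "{k\<in>{1..d}. (k \<le> i) \<noteq> b} = (if b then {i+1..d} else {1..i})"
    using assms by auto
  then show ?thesis using assms
    by (auto simp: of_bool_def sum.If_cases Int_def of_nat_diff split: if_splits)
qed

lemma sum_abs_diff_sorted_val:
  assumes "l \<in> {1..d}"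
  shows "(\<Sum>k=1..d. \<bar>sorted_val d y k - sorted_val d y l\<bar>) =
    (\<Sum>i=1..d-1. gap d y i * (if l \<le> i then real d - real i else real i))"
proof -
  have "(\<Sum>k=1..d. \<bar>sorted_val d y k - sorted_val d y l\<bar>) =
      (\<Sum>k=1..d. \<Sum>i=1..d-1. gap d y i * of_bool ((k \<le> i) \<noteq> (l \<le> i)))"
    using assms by (intro sum.cong refl abs_diff_sorted_val) auto
  also have "\<dots> = (\<Sum>i=1..d-1. gap d y i * (\<Sum>k=1..d. of_bool ((k \<le> i) \<noteq> (l \<le> i))))"
    by (subst sum.swap) (simp only: sum_distrib_left)
  also have "\<dots> = (\<Sum>i=1..d-1. gap d y i * (if l \<le> i then real d - real i else real i))"
    by (intro sum.cong refl arg_cong2[where f="(*)"] sum_of_bool_threshold) auto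
  finally show ?thesis .
qed

text \<open>Gap \<open>i\<close> has \<open>i\<close> positions below and \<open>d - i\<close>
  above, hence is crossed by \<open>i * (d - i)\<close> unordered pairs; the factor 2 counts ordered
  pairs.\<close>

lemma sum_all_abs_diff:
  "(\<Sum>l=1..d. \<Sum>k=1..d. \<bar>y k - y l\<bar>) = 2 * (\<Sum>i=1..d-1. gap d y i * (real i * (real d - real i)))"
proof -
  have count: "(\<Sum>l=1..d. if l \<le> i then real d - real i else real i) =
      2 * (real i * (real d - real i))" if "i \<in> {1..d-1}" for i
  proof -
    have "{l\<in>{1..d}. l \<le> i} = {1..i}" "{l\<in>{1..d}. \<not> l \<le> i} = {i+1..d}" "i \<le> d"
      using that by auto
    then show ?thesis
      by (simp add: sum.If_cases Int_def Collect_neg_eq[symmetric] of_nat_diff algebra_simps)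
  qed
  have "(\<Sum>l=1..d. \<Sum>k=1..d. \<bar>y k - y l\<bar>) =
      (\<Sum>l=1..d. \<Sum>k=1..d. \<bar>sorted_val d y k - sorted_val d y l\<bar>)"
    \<comment> \<open>Sorting is undone first in the inner sum, with the reference value fixed, then
      in the outer one.\<close>
    unfolding sum_sorted_val[where g="\<lambda>t. \<bar>t - _\<bar>"]
    by (rule sum_sorted_val[where g="\<lambda>s. \<Sum>k=1..d. \<bar>y k - s\<bar>", symmetric])
  also have "\<dots> = (\<Sum>l=1..d. \<Sum>i=1..d-1. gap d y i * (if l \<le> i then real d - real i else real i))"
    by (intro sum.cong refl sum_abs_diff_sorted_val) auto
  also have "\<dots> = (\<Sum>i=1..d-1. gap d y i * (\<Sum>l=1..d. if l \<le> i then real d - real i else real i))"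
    by (subst sum.swap) (simp only: sum_distrib_left)
  also have "\<dots> = (\<Sum>i=1..d-1. 2 * (gap d y i * (real i * (real d - real i))))"
    by (intro sum.cong refl, subst count) auto
  finally show ?thesis by (simp add: sum_distrib_left)
qed

text \<open>Weights in [-1, 1] of total zero give a lower bound that does not depend on
  \<open>a\<close>. It is attained at the lower median, where the weights match the signs of the
  differences.\<close>

lemma sum_abs_diff_median_le:
  assumes "e \<ge> 1"
  shows "(\<Sum>i=1..e. \<bar>y i - sorted_val e y ((e + 1) div 2)\<bar>) \<le> (\<Sum>i=1..e. \<bar>y i - a\<bar>)"
proof -
  let ?z = "sorted_val e y" and ?M = "(e + 1) div 2"
  \<comment> \<open>a subgradient of the sum of distances at the median, of total weight zero\<close>
  define t where "t i = sgn (2 * real i - (real e + 1))" for i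
  have "(\<Sum>i=1..e. t i) = (\<Sum>i=1..e. t (e + 1 - i))"
    by (rule sum.atLeastAtMost_rev)
  also have "\<dots> = (\<Sum>i=1..e. - t i)"
    unfolding t_def by (intro sum.cong refl) (auto simp: of_nat_diff sgn_if)
  finally have t0: "(\<Sum>i=1..e. t i) = 0" by (simp add: sum_negf)
  have t1: "\<bar>t i\<bar> \<le> 1" for i
    by (simp add: t_def sgn_if)
  have tz: "\<bar>?z i - ?z ?M\<bar> = t i * (?z i - ?z ?M)" if "i \<in> {1..e}" for i
  proof (cases "i = ?M")
    case False
    show ?thesis
    proof (cases "i < ?M")
      case True
      then have "t i = -1" by (auto simp: t_def sgn_if)
      moreover have "?z i \<le> ?z ?M" using True that assms by (intro sorted_val_mono) auto
      ultimately show ?thesis by simp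
    next
      case ge: False
      then have "t i = 1" using False by (auto simp: t_def sgn_if)
      moreover have "?z ?M \<le> ?z i" using ge that assms by (intro sorted_val_mono) auto
      ultimately show ?thesis by simp
    qed
  qed simp
  \<comment> \<open>Total weight zero allows the base point to be moved from the median to
    \<open>a\<close>.\<close>
  have tsum: "(\<Sum>i=1..e. t i * (?z i - b)) = (\<Sum>i=1..e. t i * ?z i)" for b
    using t0 by (simp add: right_diff_distrib sum_subtractf flip: sum_distrib_right)
  have "(\<Sum>i=1..e. \<bar>y i - ?z ?M\<bar>) = (\<Sum>i=1..e. \<bar>?z i - ?z ?M\<bar>)"
    by (rule sum_sorted_val[symmetric])
  also have "\<dots> = (\<Sum>i=1..e. t i * (?z i - ?z ?M))"
    using tz by (intro sum.cong) auto
  also have "\<dots> = (\<Sum>i=1..e. t i * (?z i - a))"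
    by (simp only: tsum)
  also have "\<dots> \<le> (\<Sum>i=1..e. \<bar>?z i - a\<bar>)"
  proof (intro sum_mono)
    fix i
    have "t i * (?z i - a) \<le> \<bar>t i\<bar> * \<bar>?z i - a\<bar>" by (metis abs_ge_self abs_mult)
    also have "\<dots> \<le> \<bar>?z i - a\<bar>" using t1[of i] by (simp add: mult_left_le_one_le)
    finally show "t i * (?z i - a) \<le> \<bar>?z i - a\<bar>" .
  qed
  also have "\<dots> = (\<Sum>i=1..e. \<bar>y i - a\<bar>)" by (rule sum_sorted_val)
  finally show ?thesis .
qed

lemma emd_cost_median:
  assumes "e \<ge> 1"
  shows "emd_cost e y = (\<Sum>i=1..e. \<bar>y i - sorted_val e y ((e + 1) div 2)\<bar>)"
  unfolding emd_cost_def
  by (rule Least_equality) (use sum_abs_diff_median_le[OF assms] in auto)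

lemma emd_cost_le:
  assumes "e \<ge> 1"
  shows "emd_cost e y \<le> (\<Sum>i=1..e. \<bar>y i - a\<bar>)"
  using sum_abs_diff_median_le[OF assms] by (simp add: emd_cost_median[OF assms])

text \<open>A minimizing center can be found among the given values. It is thus an integer in
  \<open>{1..n+1}\<close> for grid points and lies in [0, 1] for cumulative sums, as the threshold
  and integral formulas require.\<close>

lemma emd_cost_minimizer:
  assumes "e \<ge> 1"
  obtains p where "p \<in> {1..e}" "emd_cost e y = (\<Sum>i=1..e. \<bar>y i - y p\<bar>)"
proof -
  have "(e + 1) div 2 \<in> {1..e}" using assms by auto
  from sorted_val_attained[OF this, of y] that show ?thesis
    by (metis emd_cost_median[OF assms])
qed

text \<open>Seen from the median, a gap is crossed by all positions on the side away from it, which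
  is never the larger side.\<close>

lemma emd_cost_gap:
  assumes "d \<ge> 1"
  shows "emd_cost d y = (\<Sum>i=1..d-1. gap d y i * real (min i (d - i)))"
proof -
  let ?M = "(d + 1) div 2"
  have "emd_cost d y = (\<Sum>k=1..d. \<bar>sorted_val d y k - sorted_val d y ?M\<bar>)"
    unfolding emd_cost_median[OF assms] by (rule sum_sorted_val[symmetric])
  also have "\<dots> = (\<Sum>i=1..d-1. gap d y i * (if ?M \<le> i then real d - real i else real i))"
    using assms by (intro sum_abs_diff_sorted_val) auto
  also have "\<dots> = (\<Sum>i=1..d-1. gap d y i * real (min i (d - i)))"
    by (intro sum.cong refl arg_cong2[where f="(*)"]) (auto simp: min_def of_nat_diff)
  finally show ?thesis .
qed

lemma emd_cost_2: "emd_cost 2 y = \<bar>y 1 - y 2\<bar>"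
proof -
  have two: "{1..2::nat} = {1, 2}" by auto
  show ?thesis unfolding emd_cost_def two
  proof (rule Least_equality)
    show "\<exists>a. \<bar>y 1 - y 2\<bar> = (\<Sum>i\<in>{1, 2}. \<bar>y i - a\<bar>)" by (intro exI[of _ "y 1"]) simp
  qed auto
qed

section \<open>Thresholds and the lower bound\<close>

text \<open>An integer is recovered by counting its threshold indicators; inverting this count later
  yields a center for the quantile coupling.\<close>

lemma sum_of_bool_le:
  assumes "q \<in> {1..n+1}"
  shows "(\<Sum>j=1..n. of_bool (q \<le> j)) = real n + 1 - real q"
proof -
  have "{j\<in>{1..n}. q \<le> j} = {q..n}" using assms by auto
  then show ?thesis using assms
    by (auto simp: of_bool_def sum.If_cases Int_def of_nat_diff)
qed

lemma abs_diff_thresholds: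
  assumes "p \<in> {1..n+1}" "q \<in> {1..n+1}"
  shows "\<bar>real p - real q\<bar> = (\<Sum>j=1..n. \<bar>of_bool (p \<le> j) - of_bool (q \<le> j)\<bar>)"
  using assms
proof (induction p q rule: linorder_wlog)
  case (le p q)
  have "(\<Sum>j=1..n. \<bar>of_bool (p \<le> j) - of_bool (q \<le> j)\<bar>) =
      (\<Sum>j=1..n. of_bool (p \<le> j) - of_bool (q \<le> j) :: real)"
    using le by (intro sum.cong) auto
  then show ?case using le sum_of_bool_le by (simp add: sum_subtractf)
next
  case (sym p q)
  then show ?case by (simp add: abs_minus_commute)
qed

lemma finite_grid [simp]: "finite (grid n e)"
  unfolding grid_def by (intro finite_PiE) auto

lemma grid_mem: "y \<in> grid n e \<Longrightarrow> i \<in> {1..e} \<Longrightarrow> y i \<in> {1..n+1}"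
  unfolding grid_def by (rule PiE_mem)

text \<open>Adding the marginal constraints for levels up to \<open>j\<close> makes the cumulative
  sum the \<open>T\<close>-average of a threshold indicator.\<close>

lemma cumul_eq_sum_plan:
  assumes T: "T \<in> transport_plans n e w" and i: "i \<in> {1..e}" and j: "j \<le> n + 1"
  shows "cumul w i j = (\<Sum>y\<in>grid n e. T y * of_bool (y i \<le> j))"
proof -
  have "cumul w i j = (\<Sum>m=1..j. \<Sum>y\<in>{y\<in>grid n e. y i = m}. T y)"
    unfolding cumul_def using T i j unfolding transport_plans_def
    by (intro sum.cong refl) auto
  also have "\<dots> = (\<Sum>m=1..j. \<Sum>y\<in>{y\<in>{y\<in>grid n e. y i \<le> j}. y i = m}. T y)"
    by (intro sum.cong refl) auto
  also have "\<dots> = (\<Sum>y\<in>{y\<in>grid n e. y i \<le> j}. T y)"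
    using grid_mem[OF _ i] by (intro sum.group) fastforce+
  also have "\<dots> = (\<Sum>y\<in>grid n e. T y * of_bool (y i \<le> j))"
    by (intro sum.mono_neutral_cong_left) auto
  finally show ?thesis .
qed

lemma transport_cost_ge:
  assumes e: "e \<ge> 1" and T: "T \<in> transport_plans n e w"
  shows "(\<Sum>j=1..n. emd_cost e (\<lambda>i. cumul w i j)) \<le>
    (\<Sum>y\<in>grid n e. emd_cost e (\<lambda>i. real (y i)) * T y)"
proof -
  have "\<exists>p. p \<in> {1..e} \<and> emd_cost e (\<lambda>i. real (y i)) = (\<Sum>i=1..e. \<bar>real (y i) - real (y p)\<bar>)" for y
    by (rule emd_cost_minimizer[OF e, of "\<lambda>i. real (y i)"]) blast
  then obtain p where p: "p y \<in> {1..e}"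
    and cost: "emd_cost e (\<lambda>i. real (y i)) = (\<Sum>i=1..e. \<bar>real (y i) - real (y (p y))\<bar>)" for y
    by metis
  let ?b = "\<lambda>y i j. of_bool (y i \<le> j) :: real"
  let ?D = "\<lambda>y i j. T y * \<bar>?b y i j - ?b y (p y) j\<bar>"
  have T0: "0 \<le> T y" if "y \<in> grid n e" for y
    using T that unfolding transport_plans_def by auto
  have "emd_cost e (\<lambda>i. cumul w i j) \<le> (\<Sum>i=1..e. \<Sum>y\<in>grid n e. ?D y i j)" if "j \<in> {1..n}"
    for j
  proof -
    \<comment> \<open>The \<open>T\<close>-average of the indicator of the minimizing coordinate. It
      does not depend on \<open>i\<close>, so it is an admissible center for the cumulative sums at
      \<open>j\<close>.\<close>
    let ?a = "\<Sum>y\<in>grid n e. T y * ?b y (p y) j"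
    have "emd_cost e (\<lambda>i. cumul w i j) \<le> (\<Sum>i=1..e. \<bar>cumul w i j - ?a\<bar>)"
      by (rule emd_cost_le[OF e])
    also have "\<dots> \<le> (\<Sum>i=1..e. \<Sum>y\<in>grid n e. ?D y i j)"
    proof (intro sum_mono)
      fix i assume i: "i \<in> {1..e}"
      have "cumul w i j - ?a = (\<Sum>y\<in>grid n e. T y * (?b y i j - ?b y (p y) j))"
        using cumul_eq_sum_plan[OF T i, of j] that
        by (simp only: right_diff_distrib sum_subtractf) auto
      also have "\<bar>\<dots>\<bar> \<le> (\<Sum>y\<in>grid n e. \<bar>T y * (?b y i j - ?b y (p y) j)\<bar>)"
        by (rule sum_abs)
      also have "\<dots> = (\<Sum>y\<in>grid n e. ?D y i j)"
        using T0 by (intro sum.cong) (auto simp: abs_mult)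
      finally show "\<bar>cumul w i j - ?a\<bar> \<le> (\<Sum>y\<in>grid n e. ?D y i j)" .
    qed
    finally show ?thesis .
  qed
  then have "(\<Sum>j=1..n. emd_cost e (\<lambda>i. cumul w i j)) \<le>
      (\<Sum>j=1..n. \<Sum>i=1..e. \<Sum>y\<in>grid n e. ?D y i j)"
    by (intro sum_mono) auto
  also have "\<dots> = (\<Sum>y\<in>grid n e. \<Sum>i=1..e. \<Sum>j=1..n. ?D y i j)"
    by (subst sum.swap, subst (2) sum.swap, subst sum.swap) simp
  also have "\<dots> = (\<Sum>y\<in>grid n e. emd_cost e (\<lambda>i. real (y i)) * T y)"
  proof (intro sum.cong refl)
    fix y assume y: "y \<in> grid n e"
    have "(\<Sum>j=1..n. ?D y i j) = T y * \<bar>real (y i) - real (y (p y))\<bar>" if "i \<in> {1..e}" for i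
      unfolding abs_diff_thresholds[OF grid_mem[OF y that] grid_mem[OF y p]]
      by (simp add: sum_distrib_left)
    then show "(\<Sum>i=1..e. \<Sum>j=1..n. ?D y i j) = emd_cost e (\<lambda>i. real (y i)) * T y"
      by (simp add: cost sum_distrib_left mult.commute)
  qed
  finally show ?thesis .
qed

section \<open>The quantile coupling\<close>

lemma has_integral_less:
  assumes "0 \<le> b" "b \<le> (1::real)"
  shows "has_bochner_integral (restrict_space lborel {0..<1}) (\<lambda>u. of_bool (u < b) :: real) b"
proof -
  let ?M = "restrict_space lborel {0..<1::real}"
  have "emeasure ?M {0..<b} = ennreal b"
    using assms by (subst emeasure_restrict_space) auto
  moreover from this have "has_bochner_integral ?M (indicator {0..<b}) (measure ?M {0..<b})"
    using assms
    by (intro has_bochner_integral_real_indicator) (auto simp: sets_restrict_space_iff)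
  ultimately have "has_bochner_integral ?M (indicator {0..<b}) b"
    using assms by (simp add: measure_def)
  then show ?thesis
    by (subst has_bochner_integral_cong[where g="indicator {0..<b}" and y=b])
      (auto simp: space_restrict_space)
qed

text \<open>Indicators driven by one common \<open>u\<close> are ordered, so no cancellation occurs:
  the triangle inequality behind the lower bound becomes an equality.\<close>

lemma has_integral_abs_diff_less:
  assumes "a \<in> {0..1}" "b \<in> {0..1::real}"
  shows "has_bochner_integral (restrict_space lborel {0..<1})
    (\<lambda>u. \<bar>of_bool (u < a) - of_bool (u < b)\<bar> :: real) \<bar>a - b\<bar>"
  using assms
proof (induction a b rule: linorder_wlog)
  case (le a b)
  then have "has_bochner_integral (restrict_space lborel {0..<1})
      (\<lambda>u. of_bool (u < b) - of_bool (u < a) :: real) (b - a)"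
    by (intro has_bochner_integral_diff has_integral_less) auto
  also have "(\<lambda>u. of_bool (u < b) - of_bool (u < a)) =
      (\<lambda>u. \<bar>of_bool (u < a) - of_bool (u < b)\<bar> :: real)"
    using le by (auto simp: fun_eq_iff)
  finally show ?case using le by simp
next
  case (sym a b)
  then show ?case by (simp add: abs_minus_commute)
qed

section \<open>Cumulative distribution functions and their generalized inverses\<close>

lemma cumul_0 [simp]: "cumul w i 0 = 0"
  by (simp add: cumul_def)

lemma cumul_mono:
  assumes "w i \<in> prob_simplex n" "j \<le> k" "k \<le> n + 1"
  shows "cumul w i j \<le> cumul w i k"
  unfolding cumul_def using assms by (intro sum_mono2) (auto simp: prob_simplex_def)

lemma cumul_total: "w i \<in> prob_simplex n \<Longrightarrow> cumul w i (n + 1) = 1"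
  by (simp add: cumul_def prob_simplex_def)

lemma cumul_bounds:
  assumes "w i \<in> prob_simplex n" "j \<le> n + 1"
  shows "cumul w i j \<in> {0..1}"
  using cumul_mono[of w i n 0 j] cumul_mono[of w i n j "n + 1"] cumul_total[of w i n] assms by simp

text \<open>The generalized inverse of each cumulative distribution function, all evaluated at the
  same \<open>u\<close>. Restriction to \<open>{1..e}\<close> matches the extensional functions in
  \<open>grid\<close>.\<close>

definition quantile :: "nat \<Rightarrow> (nat \<Rightarrow> nat \<Rightarrow> real) \<Rightarrow> real \<Rightarrow> nat \<Rightarrow> nat" where
  "quantile e w u = (\<lambda>i\<in>{1..e}. LEAST j. u < cumul w i j)"

text \<open>Total mass 1 at level \<open>n + 1\<close> exceeds \<open>u\<close>, so the
  \<open>LEAST\<close> is attained; monotonicity of \<open>cumul\<close> then carries the strict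
  inequality upward.\<close>

lemma quantile_le_iff:
  assumes "w i \<in> prob_simplex n" "i \<in> {1..e}" "u < 1" "j \<le> n + 1"
  shows "quantile e w u i \<le> j \<longleftrightarrow> u < cumul w i j"
proof -
  have "u < cumul w i (n + 1)" using cumul_total[of w i n] assms by simp
  then have "u < cumul w i (LEAST j. u < cumul w i j)" by (rule LeastI)
  then show ?thesis
    using cumul_mono[of w i n "LEAST j. u < cumul w i j" j] assms
    by (auto simp: quantile_def intro: Least_le)
qed

lemma quantile_eq_iff:
  assumes "w i \<in> prob_simplex n" "i \<in> {1..e}" "u < 1" "j \<in> {1..n+1}"
  shows "quantile e w u i = j \<longleftrightarrow> u < cumul w i j \<and> \<not> u < cumul w i (j - 1)"
proof -
  obtain k where j: "j = Suc k" using assms(4) by (cases j) auto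
  show ?thesis
    using quantile_le_iff[of w i n e u j] quantile_le_iff[of w i n e u k] assms
    unfolding j by auto
qed

lemma quantile_in_grid:
  assumes "\<And>i. i \<in> {1..e} \<Longrightarrow> w i \<in> prob_simplex n" "0 \<le> u" "u < 1"
  shows "quantile e w u \<in> grid n e"
  unfolding grid_def
proof (rule PiE_I)
  fix i assume i: "i \<in> {1..e}"
  \<comment> \<open>Level 0 is excluded because \<open>cumul w i 0 = 0\<close> does not exceed
    \<open>u\<close>.\<close>
  have "quantile e w u i \<le> n + 1" "\<not> quantile e w u i \<le> 0"
    using quantile_le_iff[of w i n e u "n + 1"] quantile_le_iff[of w i n e u 0]
      cumul_total[of w i n] assms i
    by simp_all
  then show "quantile e w u i \<in> {1..n+1}" by simp
qed (auto simp: quantile_def restrict_def)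

text \<open>The joint law of the quantile vector when \<open>u\<close> is uniform on [0, 1): the
  comonotone coupling.\<close>

definition quantile_plan :: "nat \<Rightarrow> (nat \<Rightarrow> nat \<Rightarrow> real) \<Rightarrow> (nat \<Rightarrow> nat) \<Rightarrow> real" where
  "quantile_plan e w y =
    measure (restrict_space lborel {0..<1}) {u\<in>{0..<1}. quantile e w u = y}"

lemma has_integral_quantile_plan:
  assumes w: "\<And>i. i \<in> {1..e} \<Longrightarrow> w i \<in> prob_simplex n" and y: "y \<in> grid n e"
  shows "has_bochner_integral (restrict_space lborel {0..<1})
    (\<lambda>u. of_bool (quantile e w u = y)) (quantile_plan e w y)"
proof -
  let ?M = "restrict_space lborel {0..<1::real}" and ?A = "{u\<in>{0..<1}. quantile e w u = y}"
  \<comment> \<open>Measurability: the event becomes finitely many inequalities in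
    \<open>u\<close>.\<close>
  have "quantile e w u = y \<longleftrightarrow>
      (\<forall>i\<in>{1..e}. u < cumul w i (y i) \<and> \<not> u < cumul w i (y i - 1))" if "u \<in> {0..<1}" for u
  proof -
    have "quantile e w u \<in> grid n e" using quantile_in_grid[of e w n u] w that by simp
    then have "quantile e w u = y \<longleftrightarrow> (\<forall>i\<in>{1..e}. quantile e w u i = y i)"
      using y unfolding grid_def by (blast intro: PiE_ext)
    also have "\<dots> \<longleftrightarrow> (\<forall>i\<in>{1..e}. u < cumul w i (y i) \<and> \<not> u < cumul w i (y i - 1))"
      using w grid_mem[OF y] that by (intro ball_cong refl quantile_eq_iff[where n=n]) simp_all
    finally show ?thesis .
  qed
  then have "?A = {u\<in>space lborel. u \<in> {0..<1} \<and>
      (\<forall>i\<in>{1..e}. u < cumul w i (y i) \<and> \<not> u < cumul w i (y i - 1))}"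
    by auto
  also have "\<dots> \<in> sets lborel" by measurable
  finally have A: "?A \<in> sets lborel" .
  have "emeasure lborel ?A \<le> emeasure lborel {0..<1::real}"
    using A by (intro emeasure_mono) auto
  then have "emeasure lborel ?A < \<infinity>" by (simp add: le_less_trans)
  then have "emeasure ?M ?A < \<infinity>"
    by (subst emeasure_restrict_space) auto
  then have "has_bochner_integral ?M (indicator ?A) (quantile_plan e w y)"
    unfolding quantile_plan_def using A
    by (intro has_bochner_integral_real_indicator) (auto simp: sets_restrict_space_iff)
  then show ?thesis
    by (subst has_bochner_integral_cong[where g="indicator ?A"])
      (auto simp: space_restrict_space)
qed

text \<open>The \<open>i\<close>th quantile equals \<open>j\<close> on the interval from
  \<open>cumul w i (j - 1)\<close> to \<open>cumul w i j\<close>, of length \<open>w i j\<close>.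
  The marginal sum and this length are integrals of the same function, hence equal.\<close>

lemma quantile_plan_transport:
  assumes w: "\<And>i. i \<in> {1..e} \<Longrightarrow> w i \<in> prob_simplex n"
  shows "quantile_plan e w \<in> transport_plans n e w"
  unfolding transport_plans_def
proof (intro CollectI conjI ballI)
  fix y show "0 \<le> quantile_plan e w y" by (simp add: quantile_plan_def)
next
  fix i j assume i: "i \<in> {1..e}" and j: "j \<in> {1..n+1}"
  let ?M = "restrict_space lborel {0..<1::real}" and ?S = "{y\<in>grid n e. y i = j}"
  have A: "has_bochner_integral ?M (\<lambda>u. \<Sum>y\<in>?S. of_bool (quantile e w u = y))
      (\<Sum>y\<in>?S. quantile_plan e w y)"
    using w by (intro has_bochner_integral_sum has_integral_quantile_plan) auto
  have B: "has_bochner_integral ?M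
      (\<lambda>u. of_bool (u < cumul w i j) - of_bool (u < cumul w i (j - 1)))
      (cumul w i j - cumul w i (j - 1))"
    using cumul_bounds[of w i n j] cumul_bounds[of w i n "j - 1"] w[OF i] j
    by (intro has_bochner_integral_diff has_integral_less) auto
  have C: "(\<Sum>y\<in>?S. of_bool (quantile e w u = y)) =
      (of_bool (u < cumul w i j) - of_bool (u < cumul w i (j - 1)) :: real)"
    if "u \<in> space ?M" for u
  proof -
    have u: "0 \<le> u" "u < 1" using that by (auto simp: space_restrict_space)
    have "(\<Sum>y\<in>?S. of_bool (quantile e w u = y)) = (of_bool (quantile e w u \<in> ?S) :: real)"
      by (simp add: of_bool_def)
    also have "quantile e w u \<in> ?S \<longleftrightarrow> u < cumul w i j \<and> \<not> u < cumul w i (j - 1)"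
      using quantile_in_grid[of e w n u] quantile_eq_iff[of w i n e u j] w i j u by auto
    finally show ?thesis
      using cumul_mono[of w i n "j - 1" j] w[OF i] j by auto
  qed
  have "has_bochner_integral ?M (\<lambda>u. \<Sum>y\<in>?S. of_bool (quantile e w u = y))
      (cumul w i j - cumul w i (j - 1))"
    by (subst has_bochner_integral_cong[OF refl C refl], assumption, rule B)
  with A have "(\<Sum>y\<in>?S. quantile_plan e w y) = cumul w i j - cumul w i (j - 1)"
    by (rule has_bochner_integral_eq)
  also have "\<dots> = w i j"
    using j by (cases j) (simp_all add: cumul_def)
  finally show "(\<Sum>y\<in>?S. quantile_plan e w y) = w i j" .
qed

text \<open>The cost is bounded pointwise in \<open>u\<close> by threshold distances to the
  minimizing marginals, whose integrals are the costs of the cumulative sums.\<close>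

lemma quantile_plan_cost_le:
  assumes e: "e \<ge> 1" and w: "\<And>i. i \<in> {1..e} \<Longrightarrow> w i \<in> prob_simplex n"
  shows "(\<Sum>y\<in>grid n e. emd_cost e (\<lambda>i. real (y i)) * quantile_plan e w y) \<le>
    (\<Sum>j=1..n. emd_cost e (\<lambda>i. cumul w i j))"
proof -
  let ?M = "restrict_space lborel {0..<1::real}" and ?c = "\<lambda>y. emd_cost e (\<lambda>i. real (y i))"
  have "\<exists>p. p \<in> {1..e} \<and> emd_cost e (\<lambda>i. cumul w i j) = (\<Sum>i=1..e. \<bar>cumul w i j - cumul w p j\<bar>)"
    for j
    by (rule emd_cost_minimizer[OF e, of "\<lambda>i. cumul w i j"]) blast
  then obtain p where p: "p j \<in> {1..e}"
    and cost: "emd_cost e (\<lambda>i. cumul w i j) = (\<Sum>i=1..e. \<bar>cumul w i j - cumul w (p j) j\<bar>)" for j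
    by metis
  have bounds: "cumul w i j \<in> {0..1}" if "i \<in> {1..e}" "j \<in> {1..n}" for i j
    using cumul_bounds[of w i n j] w that by simp
  let ?m = "\<lambda>j. cumul w (p j) j"
  let ?R = "\<lambda>u. \<Sum>j=1..n. \<Sum>i=1..e. \<bar>of_bool (u < cumul w i j) - of_bool (u < ?m j)\<bar> :: real"
  have A: "has_bochner_integral ?M (\<lambda>u. \<Sum>y\<in>grid n e. ?c y * of_bool (quantile e w u = y))
      (\<Sum>y\<in>grid n e. ?c y * quantile_plan e w y)"
    using w by (intro has_bochner_integral_sum has_bochner_integral_mult_right
        has_integral_quantile_plan) auto
  have B: "has_bochner_integral ?M ?R (\<Sum>j=1..n. emd_cost e (\<lambda>i. cumul w i j))"
    unfolding cost by (intro has_bochner_integral_sum has_integral_abs_diff_less bounds p)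
  have "(\<Sum>y\<in>grid n e. ?c y * of_bool (quantile e w u = y)) \<le> ?R u"
    if "u \<in> space ?M" for u
  proof -
    let ?Y = "quantile e w u"
    have u: "0 \<le> u" "u < 1" using that by (auto simp: space_restrict_space)
    have Y: "?Y \<in> grid n e" using quantile_in_grid w u by blast
    \<comment> \<open>The number whose threshold count is that of the indicators
      \<open>u < ?m j\<close>. Since \<open>p j\<close> varies with \<open>j\<close>, it need not be
      a coordinate of \<open>?Y\<close>, but any real center bounds the cost from above.\<close>
    define a where "a = real n + 1 - (\<Sum>j=1..n. of_bool (u < ?m j))"
    have "(\<Sum>y\<in>grid n e. ?c y * of_bool (?Y = y)) = ?c ?Y"
      using Y by (simp add: of_bool_def if_distrib[of "(*) _"] cong: if_cong)
    also have "\<dots> \<le> (\<Sum>i=1..e. \<bar>real (?Y i) - a\<bar>)" by (rule emd_cost_le[OF e])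
    also have "\<dots> \<le> (\<Sum>i=1..e. \<Sum>j=1..n. \<bar>of_bool (u < cumul w i j) - of_bool (u < ?m j)\<bar>)"
    proof (intro sum_mono)
      fix i assume i: "i \<in> {1..e}"
      have "a - real (?Y i) = (\<Sum>j=1..n. of_bool (?Y i \<le> j)) - (\<Sum>j=1..n. of_bool (u < ?m j))"
        using sum_of_bool_le[OF grid_mem[OF Y i]] by (simp add: a_def)
      also have "\<dots> = (\<Sum>j=1..n. of_bool (u < cumul w i j) - of_bool (u < ?m j))"
        unfolding sum_subtractf
        by (intro arg_cong2[where f="(-)"] sum.cong refl)
          (use quantile_le_iff[of w i n e u] w i u in auto)
      finally show "\<bar>real (?Y i) - a\<bar> \<le>
          (\<Sum>j=1..n. \<bar>of_bool (u < cumul w i j) - of_bool (u < ?m j)\<bar>)"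
        by (simp only: abs_minus_commute[of "real (?Y i)"] sum_abs)
    qed
    also have "\<dots> = ?R u" by (rule sum.swap)
    finally show ?thesis .
  qed
  with A B have "(\<integral>u. (\<Sum>y\<in>grid n e. ?c y * of_bool (quantile e w u = y)) \<partial>?M) \<le>
      (\<integral>u. ?R u \<partial>?M)"
    by (intro integral_mono) (simp_all only: has_bochner_integral_iff)
  then show ?thesis
    by (simp only: has_bochner_integral_integral_eq[OF A] has_bochner_integral_integral_eq[OF B])
qed

text \<open>The lower bound holds for every plan and the quantile plan attains it, so the
  \<open>LEAST\<close> is a true minimum.\<close>

theorem EMD_eq_sum_emd_cost:
  assumes "e \<ge> 1" and "\<And>i. i \<in> {1..e} \<Longrightarrow> w i \<in> prob_simplex n"
  shows "EMD n e w = (\<Sum>j=1..n. emd_cost e (\<lambda>i. cumul w i j))"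
  unfolding EMD_def
proof (rule Least_equality)
  have "quantile_plan e w \<in> transport_plans n e w"
    by (rule quantile_plan_transport[OF assms(2)])
  then show "\<exists>T\<in>transport_plans n e w. (\<Sum>j=1..n. emd_cost e (\<lambda>i. cumul w i j)) =
      (\<Sum>y\<in>grid n e. emd_cost e (\<lambda>i. real (y i)) * T y)"
    using quantile_plan_cost_le[OF assms] transport_cost_ge[OF assms(1)]
    by (intro bexI[of _ "quantile_plan e w"] antisym) auto
qed (use transport_cost_ge[OF assms(1)] in auto)

section \<open>The identity\<close>

lemma EMD_pair_eq:
  assumes "u \<in> prob_simplex n" "v \<in> prob_simplex n"
  shows "EMD_pair n u v = (\<Sum>j=1..n. \<bar>(\<Sum>m=1..j. u m) - (\<Sum>m=1..j. v m)\<bar>)"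
  unfolding EMD_pair_def using assms
  by (subst EMD_eq_sum_emd_cost) (auto simp: emd_cost_2 cumul_def)

text \<open>The index square splits into two triangles, equal by symmetry, and a diagonal that
  contributes zero.\<close>

lemma sum_pairs:
  fixes f :: "nat \<Rightarrow> nat \<Rightarrow> real"
  assumes "\<And>k l. f k l = f l k" "\<And>k. f k k = 0"
  shows "2 * (\<Sum>(k, l)\<in>{(k, l). 1 \<le> k \<and> k < l \<and> l \<le> d}. f k l) = (\<Sum>l=1..d. \<Sum>k=1..d. f k l)"
proof -
  let ?A = "{(k, l). 1 \<le> k \<and> k < l \<and> l \<le> d}" and ?B = "{(k, l). 1 \<le> l \<and> l < k \<and> k \<le> d}"
  let ?D = "{(k, l). k = l \<and> 1 \<le> k \<and> k \<le> d}"
  have fin: "finite ?A" "finite ?B" "finite ?D"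
    by (rule finite_subset[of _ "{1..d} \<times> {1..d}"]; auto)+
  have "(\<Sum>l=1..d. \<Sum>k=1..d. f k l) = (\<Sum>(k, l)\<in>{1..d} \<times> {1..d}. f k l)"
    by (subst sum.swap) (rule sum.cartesian_product)
  also have "{1..d} \<times> {1..d} = ?A \<union> ?B \<union> ?D" by auto
  also have "(\<Sum>(k, l)\<in>\<dots>. f k l) =
      (\<Sum>(k, l)\<in>?A. f k l) + (\<Sum>(k, l)\<in>?B. f k l) + (\<Sum>(k, l)\<in>?D. f k l)"
    using fin by (subst sum.union_disjoint; (subst sum.union_disjoint)?) auto
  also have "(\<Sum>(k, l)\<in>?B. f k l) = (\<Sum>(k, l)\<in>?A. f k l)"
    using assms(1)
    by (intro sum.reindex_bij_witness[where i="\<lambda>(k, l). (l, k)" and j="\<lambda>(k, l). (l, k)"]) auto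
  also have "(\<Sum>(k, l)\<in>?D. f k l) = 0" using assms(2) by (intro sum.neutral) auto
  finally show ?thesis by simp
qed

lemma gap_cumul: "gap d (\<lambda>k. cumul x k j) i = delta_stat d x i j"
  by (simp add: gap_def delta_stat_def order_stat_def sorted_val_def)

lemma sum_EMD_pair:
  assumes "\<And>i. i \<in> {1..d} \<Longrightarrow> x i \<in> prob_simplex n"
  shows "(\<Sum>(k, l)\<in>{(k, l). 1 \<le> k \<and> k < l \<and> l \<le> d}. EMD_pair n (x k) (x l)) =
    (\<Sum>j=1..n. \<Sum>i=1..d-1. delta_stat d x i j * (real i * (real d - real i)))"
proof -
  let ?P = "{(k, l). 1 \<le> k \<and> k < l \<and> l \<le> d}"
  have "(\<Sum>(k, l)\<in>?P. EMD_pair n (x k) (x l)) =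
      (\<Sum>(k, l)\<in>?P. \<Sum>j=1..n. \<bar>cumul x k j - cumul x l j\<bar>)"
    using assms by (intro sum.cong refl) (auto simp: EMD_pair_eq cumul_def)
  also have "\<dots> = (\<Sum>j=1..n. \<Sum>(k, l)\<in>?P. \<bar>cumul x k j - cumul x l j\<bar>)"
    by (subst sum.swap) (simp add: case_prod_unfold)
  also have "\<dots> = (\<Sum>j=1..n. \<Sum>i=1..d-1. delta_stat d x i j * (real i * (real d - real i)))"
  proof (intro sum.cong refl)
    fix j
    \<comment> \<open>Doubling passes to ordered pairs, where the gap count applies.\<close>
    have "2 * (\<Sum>(k, l)\<in>?P. \<bar>cumul x k j - cumul x l j\<bar>) =
        2 * (\<Sum>i=1..d-1. gap d (\<lambda>k. cumul x k j) i * (real i * (real d - real i)))"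
      by (subst sum_pairs; (rule abs_minus_commute | rule sum_all_abs_diff | simp))
    then show "(\<Sum>(k, l)\<in>?P. \<bar>cumul x k j - cumul x l j\<bar>) =
        (\<Sum>i=1..d-1. delta_stat d x i j * (real i * (real d - real i)))"
      by (simp add: gap_cumul)
  qed
  finally show ?thesis .
qed

lemma poly_pderiv2_G_poly:
  "poly (pderiv (pderiv (G_poly n d x))) 1 = (\<Sum>j=1..n. \<Sum>i=1..d-1.
    delta_stat d x i j * (real (min i (d - i)) * (real (min i (d - i)) - 1)))"
proof -
  have "poly (pderiv (pderiv (G_poly n d x))) 1 = (\<Sum>i=1..d-1. \<Sum>j=1..n.
      real (min i (d - i) - 1) * (real (min i (d - i)) * delta_stat d x i j))"
    unfolding G_poly_def
    by (simp only: higher_pderiv_sum[of 1, simplified] poly_sum pderiv_monom poly_monom) simp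
  also have "\<dots> = (\<Sum>i=1..d-1. \<Sum>j=1..n.
      delta_stat d x i j * (real (min i (d - i)) * (real (min i (d - i)) - 1)))"
    \<comment> \<open>Here \<open>min i (d - i)\<close> is at least 1, so subtracting 1 in the
      naturals agrees with the reals.\<close>
    by (intro sum.cong refl) (auto simp: of_nat_diff)
  finally show ?thesis by (subst sum.swap)
qed

theorem theorem5p1:
  fixes n d :: nat and x :: "nat \<Rightarrow> nat \<Rightarrow> real"
  assumes "n \<ge> 1" and "d \<ge> 2"
    and "\<And>i. i \<in> {1..d} \<Longrightarrow> x i \<in> prob_simplex n"
  shows "EMD n d x =
    1 / (real d - 1) *
      (poly (pderiv (pderiv (G_poly n d x))) 1 +
       (\<Sum>(k, l)\<in>{(k, l). 1 \<le> k \<and> k < l \<and> l \<le> d}. EMD_pair n (x k) (x l)))"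
proof -
  have key: "real m * (real m - 1) + real i * (real d - real i) = (real d - 1) * real m"
    if "i \<in> {1..d-1}" "m = min i (d - i)" for i m
  proof -
    have "i \<le> d" using that by auto
    then have "real (d - i) = real d - real i" by (rule of_nat_diff)
    \<comment> \<open>Either case gives \<open>i * (d - i) = m * (d - m)\<close>, and
      \<open>m * (m - 1) + m * (d - m) = m * (d - 1)\<close>.\<close>
    then have "real m = real i \<or> real i = real d - real m" using that by (auto simp: min_def)
    then show ?thesis by (elim disjE; simp only:; simp add: algebra_simps)
  qed
  have pairs: "(\<Sum>(k, l)\<in>{(k, l). 1 \<le> k \<and> k < l \<and> l \<le> d}. EMD_pair n (x k) (x l)) =
      (\<Sum>j=1..n. \<Sum>i=1..d-1. delta_stat d x i j * (real i * (real d - real i)))"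
    using assms(3) by (rule sum_EMD_pair)
  have "poly (pderiv (pderiv (G_poly n d x))) 1 +
       (\<Sum>(k, l)\<in>{(k, l). 1 \<le> k \<and> k < l \<and> l \<le> d}. EMD_pair n (x k) (x l)) =
      (\<Sum>j=1..n. \<Sum>i=1..d-1. delta_stat d x i j * ((real d - 1) * real (min i (d - i))))"
    unfolding poly_pderiv2_G_poly pairs sum.distrib[symmetric] distrib_left[symmetric]
    by (intro sum.cong refl arg_cong2[where f="(*)"] key) auto
  also have "\<dots> = (real d - 1) * (\<Sum>j=1..n. emd_cost d (\<lambda>i. cumul x i j))"
    using assms(2) by (simp add: emd_cost_gap gap_cumul sum_distrib_left mult_ac)
  also have "(\<Sum>j=1..n. emd_cost d (\<lambda>i. cumul x i j)) = EMD n d x"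
    using assms by (intro EMD_eq_sum_emd_cost[symmetric]) auto
  finally show ?thesis using assms(2) by simp
qed

end
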